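(* Let $k\ge1$ be an integer and let $q(0)=\{q_n(0)\}_{n=-\infty}^{\infty}$ be a complex sequence with $q(0)\in l^{2,k}$ and $\|q(0)\|_\infty=\sup_n|q_n(0)|<1$. Then the initial value problem for the defocusing Ablowitz–Ladik system $$i\partial_tq_n=q_{n+1}-2q_n+q_{n-1}-|q_n|^2(q_{n+1}+q_{n-1}),\qquad n\in\mathbb Z,$$ with initial data $q(0)$ has a solution $q(t)=\{q_n(t)\}_{n=-\infty}^\infty$, and $q(t)\in l^{2,k}$ for every $t\neq0$.
   Context: $l^{2,k}$ is the space of complex sequences $\{q_n\}_{n\in\mathbb Z}$ with $\sum_{n\in\mathbb Z}(1+n^2)^k|q_n|^2<\infty$. The time variable is $t\in\mathbb R$. *)

theory Defs
  imports "HOL-Analysis.Analysis"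
begin

definition l2_weighted :: "nat \<Rightarrow> (int \<Rightarrow> complex) set" where
  "l2_weighted k =
    {q. (\<lambda>n. (1 + (real_of_int n)\<^sup>2) ^ k * (cmod (q n))\<^sup>2) summable_on UNIV}"

text \<open>
  The supremum over the reals is meaningful only for bounded sequences; every element of
  \<^term>\<open>l2_weighted k\<close> is bounded.
\<close>

definition sup_norm :: "(int \<Rightarrow> complex) \<Rightarrow> real" where
  "sup_norm q = (SUP n. cmod (q n))"

text \<open>
  Solutions are global in time (positive and negative) and classical in each component:
  every \<^term>\<open>\<lambda>t. q t n\<close> is differentiable on the whole real line and the equation
  holds at every site and every time.
\<close>

definition defocusing_AL_solution :: "(real \<Rightarrow> int \<Rightarrow> complex) \<Rightarrow> bool" where
  "defocusing_AL_solution q \<longleftrightarrow>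
    (\<forall>t n. \<exists>d. ((\<lambda>s. q s n) has_vector_derivative d) (at t) \<and>
      \<i> * d = q t (n + 1) - 2 * q t n + q t (n - 1)
              - complex_of_real ((cmod (q t n))\<^sup>2) * (q t (n + 1) + q t (n - 1)))"

end

theory Submission
  imports Defs
begin

text \<open>
  Let \<open>P\<close> be the nearest-point projection onto the closed unit disc. Replacing \<open>q (n + 1)\<close>,
  \<open>q (n - 1)\<close> by \<open>P (q (n + 1))\<close>, \<open>P (q (n - 1))\<close> and the factor \<open>1 - |q n|^2\<close> by
  \<open>1 - |P (q n)|^2\<close> makes the vector field globally Lipschitz. The coupling then vanishes where
  \<open>|q n| > 1\<close>, so \<open>|q n|\<close> is stationary there; hence the closed unit disc is invariant and
  solutions of the truncated equation solve the original one.

  The truncated equation is solved for all times at once by the contraction principle in the sup norm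
  weighted by \<open>exp (- L * |t|)\<close>. For the decay, the contraction is restricted to the closed set
  \<open>|q t n| \<le> 2 * exp (L * |t|) * b n\<close>, where \<open>b\<close> majorises the initial data, lies in the weighted
  space and satisfies \<open>b (n + 1), b (n - 1) \<le> D * b n\<close>; this last property makes the set invariant
  under the Picard map for large \<open>L\<close>. One takes
  \<open>(b n)^2 = (\<Sum>m. |q0 m|^2 / (1 + (n - m)^2)^(k + 1))\<close>; Peetre's inequality
  \<open>1 + n^2 \<le> 2 * (1 + m^2) * (1 + (n - m)^2)\<close> bounds both its variation and its weighted norm.
\<close>

section \<open>Peetre's inequality and summation over the integers\<close>

lemma peetre_square:
  fixes x y :: real
  shows "1 + x\<^sup>2 \<le> 2 * (1 + y\<^sup>2) * (1 + (x - y)\<^sup>2)"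
proof -
  \<comment> \<open>The right side of the claim minus its left side is exactly this sum.\<close>
  have "0 \<le> (x - 2 * y)\<^sup>2 + 2 * (y * (x - y))\<^sup>2 + 1" by simp
  then show ?thesis by (simp add: power2_eq_square algebra_simps)
qed

lemma summable_on_int_nonneg:
  fixes f :: "int \<Rightarrow> real"
  assumes "summable (\<lambda>n. f (int n))" "summable (\<lambda>n. f (- int n))" "\<And>n. f n \<ge> 0"
  shows "f summable_on UNIV"
proof -
  have 1: "(\<lambda>n. f (int n)) summable_on UNIV" "(\<lambda>n. f (- int n)) summable_on UNIV"
    using assms by (simp_all add: summable_on_UNIV_nonneg_real_iff)
  have "f summable_on range int"
    using 1(1) by (subst summable_on_reindex) (auto simp: o_def)
  moreover have "f summable_on range (\<lambda>n. - int n)"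
    using 1(2) by (subst summable_on_reindex) (auto simp: o_def inj_on_def)
  \<comment> \<open>The two half-lines share the index 0, which is removed from the second.\<close>
  ultimately have "f summable_on (range int \<union> (range (\<lambda>n. - int n) - range int))"
    by (intro summable_on_Un_disjoint) (auto intro: summable_on_subset_banach)
  also have "range int \<union> (range (\<lambda>n. - int n) - range int) = UNIV"
    by (auto, metis int_cases2 rangeI)
  finally show ?thesis .
qed

lemma summable_on_inverse_one_plus_square:
  "(\<lambda>n::int. 1 / (1 + (real_of_int n)\<^sup>2)) summable_on UNIV"
proof (rule summable_on_int_nonneg)
  have "summable (\<lambda>n. 1 / (1 + (real n)\<^sup>2))"
  proof (rule summable_comparison_test_ev)
    show "summable (\<lambda>n. inverse (real n ^ 2))"
      by (rule inverse_power_summable) simp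
    show "\<forall>\<^sub>F n in sequentially. norm (1 / (1 + (real n)\<^sup>2)) \<le> inverse (real n ^ 2)"
      using eventually_gt_at_top[of 0]
      by eventually_elim (auto simp: field_simps add_pos_nonneg)
  qed
  then show "summable (\<lambda>n. 1 / (1 + (real_of_int (int n))\<^sup>2))"
    "summable (\<lambda>n. 1 / (1 + (real_of_int (- int n))\<^sup>2))" by simp_all
qed simp

section \<open>A slowly varying majorant in the weighted space\<close>

text \<open>The square of \<open>b\<close> is the convolution of \<open>|q|^2\<close> with the
  kernel \<open>1 / w^(k + 1)\<close>, \<open>w n = 1 + n^2\<close>. Its term \<open>m = n\<close>
  alone dominates \<open>|q n|^2\<close>. Of the \<open>k + 1\<close> kernel powers,
  \<open>k\<close> turn the weight at \<open>n\<close> into the weight at \<open>m\<close> by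
  Peetre's inequality; the last one is left to make the sum over \<open>n\<close> converge.\<close>

lemma l2_weighted_slowly_varying_majorant:
  assumes "q \<in> l2_weighted k"
  obtains b :: "int \<Rightarrow> real" and K :: real
  where "\<And>n. cmod (q n) \<le> b n" "\<And>n. b (n + 1) \<le> 2 ^ (k + 1) * b n"
    "\<And>n. b (n - 1) \<le> 2 ^ (k + 1) * b n" "\<And>n. b n \<le> K"
    "(\<lambda>n. (1 + (real_of_int n)\<^sup>2) ^ k * (b n)\<^sup>2) summable_on UNIV"
proof -
  define w :: "int \<Rightarrow> real" where "w n = 1 + (real_of_int n)\<^sup>2" for n
  define a where "a n = (cmod (q n))\<^sup>2" for n
  define B where "B n = (\<Sum>\<^sub>\<infinity>m. a m / w (n - m) ^ (k + 1))" for n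
  define b where "b n = sqrt (B n)" for n
  have w1: "w n \<ge> 1" for n by (simp add: w_def)
  then have w0: "w n > 0" for n by (rule less_le_trans[OF zero_less_one])
  have wpow1: "w n ^ j \<ge> 1" for n j using w1 by (rule one_le_power)
  have wpow0: "w n ^ j > 0" for n j using w0 by simp
  have a0: "a n \<ge> 0" for n by (simp add: a_def)
  have wp: "w x \<le> 2 * w y * w (x - y)" for x y
    using peetre_square[of "real_of_int x" "real_of_int y"] by (simp add: w_def)
  have wa: "(\<lambda>n. w n ^ k * a n) summable_on UNIV"
    using assms by (simp add: l2_weighted_def w_def a_def)
  have a_sum: "a summable_on UNIV"
  proof (rule summable_on_comparison_test[OF wa])
    show "a n \<le> w n ^ k * a n" for n
      using mult_right_mono[OF wpow1 a0] by simp
  qed (rule a0)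
  have term0: "0 \<le> a m / w (n - m) ^ (k + 1)" for n m using a0 wpow0
    by (meson divide_nonneg_pos)
  have term_le: "a m / w (n - m) ^ (k + 1) \<le> a m" for n m
    using divide_left_mono[OF wpow1[of "n - m" "k + 1"] a0[of m]] wpow0[of "n - m" "k + 1"] by simp
  have ssum: "(\<lambda>m. a m / w (n - m) ^ (k + 1)) summable_on UNIV" for n
    by (rule summable_on_comparison_test[OF a_sum]) (use term0 term_le in auto)
  have B0: "B n \<ge> 0" for n unfolding B_def by (rule infsum_nonneg) (rule term0)
  have aB: "a n \<le> B n" for n
  proof -
    have "infsum (\<lambda>m. a m / w (n - m) ^ (k + 1)) {n} \<le> B n"
      unfolding B_def by (rule infsum_mono_neutral) (use ssum term0 in auto)
    then show ?thesis by (simp add: w_def)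
  qed
  \<comment> \<open>The condition says that \<open>n\<close> and \<open>n'\<close> are neighbours,
    so one estimate serves both directions. Peetre's inequality for \<open>n - m\<close> and
    \<open>n' - m\<close> bounds the ratio of \<open>w (n - m)\<close> to \<open>w (n' - m)\<close>
    by \<open>2 * 2\<close>.\<close>
  have Bstep: "B n' \<le> 4 ^ (k + 1) * B n" if nn: "w (n - n') = 2" for n n'
  proof -
    have "B n' \<le> (\<Sum>\<^sub>\<infinity>m. 4 ^ (k + 1) * (a m / w (n - m) ^ (k + 1)))"
      unfolding B_def
    proof (rule infsum_mono[OF ssum summable_on_cmult_right[OF ssum]])
      fix m
      have "w (n - m) \<le> 4 * w (n' - m)"
        using wp[of "n - m" "n' - m"] nn by simp
      then have "w (n - m) ^ (k + 1) \<le> (4 * w (n' - m)) ^ (k + 1)"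
        by (rule power_mono) (use w0 less_imp_le in blast)
      then have "w (n - m) ^ (k + 1) \<le> 4 ^ (k + 1) * w (n' - m) ^ (k + 1)"
        by (simp only: power_mult_distrib)
      then have "a m * w (n - m) ^ (k + 1) \<le> a m * (4 ^ (k + 1) * w (n' - m) ^ (k + 1))"
        by (rule mult_left_mono[OF _ a0])
      then show "a m / w (n' - m) ^ (k + 1) \<le> 4 ^ (k + 1) * (a m / w (n - m) ^ (k + 1))"
        using wpow0[of "n' - m" "k + 1"] wpow0[of "n - m" "k + 1"]
        by (simp only: divide_le_eq times_divide_eq_right times_divide_eq_left le_divide_eq if_True
            mult.commute mult.left_commute)
    qed
    also have "\<dots> = 4 ^ (k + 1) * B n"
      unfolding B_def by (rule infsum_cmult_right[OF ssum])
    finally show ?thesis .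
  qed
  have bstep: "b n' \<le> 2 ^ (k + 1) * b n" if "w (n - n') = 2" for n n'
  proof -
    have "b n' \<le> sqrt (4 ^ (k + 1) * B n)"
      unfolding b_def using Bstep[OF that] by simp
    also have "(4::real) ^ (k + 1) = (2 ^ (k + 1))\<^sup>2"
      using power_even_eq[of "2::real" "k + 1"] by (simp add: power_mult)
    finally show ?thesis by (simp add: real_sqrt_mult b_def)
  qed
  have S: "(\<lambda>n. 1 / w n) summable_on UNIV"
    unfolding w_def by (rule summable_on_inverse_one_plus_square)
  define \<sigma> where "\<sigma> = (\<Sum>\<^sub>\<infinity>n. 1 / w n)"
  have hs: "((\<lambda>n. 1 / w (n - m)) has_sum \<sigma>) UNIV" for m
  proof -
    have "bij_betw (\<lambda>n. n - m) UNIV (UNIV :: int set)"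
      by (rule bij_betwI[of _ _ _ "\<lambda>n. n + m"]) auto
    from has_sum_reindex_bij_betw[OF this, of "\<lambda>n. 1 / w n" \<sigma>] show ?thesis
      using S unfolding \<sigma>_def by (simp add: has_sum_infsum)
  qed
  \<comment> \<open>For fixed \<open>m\<close> the sum over \<open>n\<close> is a translate with
    value \<open>\<sigma>\<close> independent of \<open>m\<close>, so this order is summed first;
    the swap afterwards gives the order required for \<open>B\<close>.\<close>
  have "(\<lambda>(m, n). 2 ^ k * (w m ^ k * a m) * (1 / w (n - m))) summable_on (UNIV \<times> UNIV)"
  proof (rule summable_on_SigmaI)
    show "((\<lambda>n. case (m, n) of (m, n) \<Rightarrow> 2 ^ k * (w m ^ k * a m) * (1 / w (n - m)))
        has_sum 2 ^ k * (w m ^ k * a m) * \<sigma>) UNIV" for m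
      using has_sum_cmult_right[OF hs[of m], of "2 ^ k * (w m ^ k * a m)"] by simp
    show "(\<lambda>m. 2 ^ k * (w m ^ k * a m) * \<sigma>) summable_on UNIV"
      by (intro summable_on_cmult_left summable_on_cmult_right wa)
  qed (use a0 w0 in \<open>auto simp: less_imp_le\<close>)
  then have "(\<lambda>(n, m). 2 ^ k * (w m ^ k * a m) * (1 / w (n - m))) summable_on (UNIV \<times> UNIV)"
    by (subst (asm) summable_on_swap) (simp add: case_prod_beta)
  then have "(\<lambda>(n, m). w n ^ k * (a m / w (n - m) ^ (k + 1))) summable_on (UNIV \<times> UNIV)"
  proof (rule summable_on_comparison_test)
    fix x :: "int \<times> int"
    obtain n m where x: "x = (n, m)" by force
    have "w n ^ k \<le> (2 * w m * w (n - m)) ^ k"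
      by (rule power_mono[OF wp]) (use w0 less_imp_le in blast)
    then have "w n ^ k * (a m / w (n - m) ^ (k + 1)) \<le>
        (2 * w m * w (n - m)) ^ k * (a m / w (n - m) ^ (k + 1))"
      by (rule mult_right_mono) (rule term0)
    also have "\<dots> = 2 ^ k * (w m ^ k * a m) * (1 / w (n - m))"
      using w0[of "n - m"] by (simp add: power_mult_distrib field_simps)
    finally show "(case x of (n, m) \<Rightarrow> w n ^ k * (a m / w (n - m) ^ (k + 1))) \<le>
        (case x of (n, m) \<Rightarrow> 2 ^ k * (w m ^ k * a m) * (1 / w (n - m)))"
      by (simp add: x)
    show "0 \<le> (case x of (n, m) \<Rightarrow> w n ^ k * (a m / w (n - m) ^ (k + 1)))"
      using mult_nonneg_nonneg[OF less_imp_le[OF wpow0[of n k]] term0[of m n]] by (simp only: x prod.case)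
  qed
  then have "(\<lambda>n. \<Sum>\<^sub>\<infinity>m. w n ^ k * (a m / w (n - m) ^ (k + 1))) summable_on UNIV"
    by (rule summable_on_Sigma_banach)
  then have "(\<lambda>n. w n ^ k * B n) summable_on UNIV"
    unfolding B_def by (simp only: infsum_cmult_right[OF ssum])
  moreover have "(b n)\<^sup>2 = B n" for n using B0 by (simp add: b_def)
  ultimately have "(\<lambda>n. (1 + (real_of_int n)\<^sup>2) ^ k * (b n)\<^sup>2) summable_on UNIV"
    by (simp add: w_def)
  moreover have "b (n + 1) \<le> 2 ^ (k + 1) * b n" "b (n - 1) \<le> 2 ^ (k + 1) * b n" for n
    by (rule bstep, simp add: w_def)+
  moreover have "cmod (q n) \<le> b n" for n
    using aB[of n] unfolding b_def a_def by (rule real_le_rsqrt)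
  \<comment> \<open>The kernel is at most 1, so the total mass of \<open>a\<close> serves for the
    uniform bound.\<close>
  moreover have "b n \<le> sqrt (infsum a UNIV)" for n
    unfolding b_def B_def by (simp only: real_sqrt_le_iff)
      (rule infsum_mono[OF ssum a_sum term_le])
  ultimately show thesis
    by (intro that[of b])
qed

section \<open>Antiderivatives and exponential bounds\<close>

lemma continuous_antiderivative:
  fixes f :: "real \<Rightarrow> complex"
  assumes "continuous_on UNIV f"
  shows "\<exists>F. F 0 = 0 \<and> (\<forall>t. (F has_vector_derivative f t) (at t))"
proof -
  obtain F where F: "\<And>t. (F has_vector_derivative f t) (at t)"
    using einterval_antiderivative[of "-\<infinity>" "\<infinity>" f] assms
    by (auto simp: continuous_on_eq_continuous_at)
  have "((\<lambda>s. F s - F 0) has_vector_derivative f t) (at t)" for t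
    using has_vector_derivative_diff_const[of F "F 0" "f t" "at t"] F by simp
  then show ?thesis by (intro exI[of _ "\<lambda>s. F s - F 0"]) simp
qed

text \<open>Integration of \<open>M * exp (L * |s|)\<close> from 0 gains a factor
  \<open>1 / L\<close>; this is what makes the Picard map contract for large \<open>L\<close>. The
  half-lines are treated separately because \<open>|t|\<close> has a corner at 0.\<close>

lemma antiderivative_exp_bound:
  fixes F :: "real \<Rightarrow> complex"
  assumes F0: "F 0 = 0" and F: "\<And>t. (F has_vector_derivative f t) (at t)"
    and bnd: "\<And>t. cmod (f t) \<le> M * exp (L * \<bar>t\<bar>)" and "L > 0"
  shows "cmod (F t) \<le> M / L * exp (L * \<bar>t\<bar>)"
proof -
  have "0 \<le> cmod (f 0)" by simp
  also have "\<dots> \<le> M" using bnd[of 0] by simp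
  finally have M_nonneg: "0 \<le> M / L" using \<open>L > 0\<close> by simp
  have cF: "continuous_on X F" for X
    by (intro continuous_at_imp_continuous_on ballI has_vector_derivative_continuous[OF F])
  consider "t = 0" | "t > 0" | "t < 0" by linarith
  then show ?thesis
  proof cases
    case 1
    then show ?thesis using F0 M_nonneg by simp
  next
    case 2
    have "norm (F t - F 0) \<le> M / L * exp (L * t) - M / L * exp (L * 0)"
    proof (rule differentiable_bound_general[OF 2 cF _ F])
      show "((\<lambda>s. M / L * exp (L * s)) has_vector_derivative M * exp (L * x)) (at x)" for x
        using \<open>L > 0\<close> unfolding has_real_derivative_iff_has_vector_derivative[symmetric]
        by (auto intro!: derivative_eq_intros)
      show "norm (f x) \<le> M * exp (L * x)" if "0 < x" for x using bnd[of x] that by simp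
    qed (use \<open>L > 0\<close> in \<open>auto intro!: continuous_intros\<close>)
    then show ?thesis using F0 M_nonneg 2 by simp
  next
    case 3
    have "norm (F 0 - F t) \<le> - (M / L * exp (- L * 0)) - - (M / L * exp (- L * t))"
    proof (rule differentiable_bound_general[OF 3 cF _ F])
      show "((\<lambda>s. - (M / L * exp (- L * s))) has_vector_derivative M * exp (- L * x)) (at x)" for x
        using \<open>L > 0\<close> unfolding has_real_derivative_iff_has_vector_derivative[symmetric]
        by (auto intro!: derivative_eq_intros)
      show "norm (f x) \<le> M * exp (- L * x)" if "x < 0" for x using bnd[of x] that by simp
    qed (use \<open>L > 0\<close> in \<open>auto intro!: continuous_intros\<close>)
    then show ?thesis using F0 M_nonneg 3 by simp
  qed
qed

section \<open>Bounded continuous functions of time and site\<close>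

text \<open>The integers are discrete, so the slices \<open>UNIV \<times> {n}\<close> form an open
  cover and continuity can be checked on each.\<close>

lemma continuous_on_times_int:
  fixes f :: "real \<times> int \<Rightarrow> 'a::topological_space"
  assumes "\<And>n. continuous_on UNIV (\<lambda>t. f (t, n))"
  shows "continuous_on UNIV f"
proof -
  have "continuous_on (\<Union>n. UNIV \<times> {n}) f"
  proof (rule continuous_on_open_UN)
    fix n :: int
    show "open (UNIV \<times> {n} :: (real \<times> int) set)"
      by (intro open_Times open_UNIV open_discrete)
    have "continuous_on (UNIV \<times> {n}) (\<lambda>x. f (fst x, n))"
      by (rule continuous_on_compose2[OF assms[of n]]) (auto intro!: continuous_intros)
    then show "continuous_on (UNIV \<times> {n}) f"
      by (rule continuous_on_eq) auto
  qed
  moreover have "(\<Union>n. UNIV \<times> {n}) = (UNIV :: (real \<times> int) set)" by auto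
  ultimately show ?thesis by simp
qed

text \<open>
  The library instance \<^class>\<open>complete_space\<close> and its closedness lemma for \<^const>\<open>PiC\<close> both ask
  for a metric domain, which excludes \<^typ>\<open>int\<close>.
\<close>

lemma complete_PiC:
  fixes X :: "'a::topological_space \<Rightarrow> 'b::complete_space set"
  assumes X: "\<And>x. closed (X x)"
  shows "complete (PiC UNIV X)"
  unfolding complete_def
proof (intro allI impI, elim conjE)
  fix f :: "nat \<Rightarrow> 'a \<Rightarrow>\<^sub>C 'b"
  assume f: "\<forall>n. f n \<in> PiC UNIV X" and "Cauchy f"
  then obtain g where "uniform_limit UNIV f g sequentially"
    using uniformly_convergent_eq_cauchy[of "\<lambda>_. True" f]
    unfolding Cauchy_def uniform_limit_sequentially_iff
    by (metis dist_fun_lt_imp_dist_val_lt)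
  from uniform_limit_bcontfunE[OF this sequentially_bot]
  obtain l where l: "f \<longlonglongrightarrow> l" by metis
  have "apply_bcontfun l x \<in> X x" for x
  proof (rule Lim_in_closed_set[OF X _ sequentially_bot])
    show "\<forall>\<^sub>F n in sequentially. apply_bcontfun (f n) x \<in> X x"
      using f by (intro always_eventually) (auto simp: mem_PiC_iff Pi_iff)
    show "(\<lambda>n. apply_bcontfun (f n) x) \<longlonglongrightarrow> apply_bcontfun l x"
      using tendsto_bcontfun_uniform_limit[OF l] by (rule tendsto_uniform_limitI) simp
  qed
  then show "\<exists>l\<in>PiC UNIV X. f \<longlonglongrightarrow> l"
    using l by (auto simp: mem_PiC_iff)
qed

section \<open>Global solutions of Lipschitz lattice equations\<close>

text \<open>Picard iteration for the rescaled unknown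
  \<open>p (t, n) = q t n / exp (L * |t|)\<close>, which turns the weighted norm into the plain sup
  norm over all times and sites. The pointwise bound by \<open>b\<close> is part of the complete set
  \<open>S\<close>, so the fixed point inherits it.\<close>

lemma lattice_ode_solution:
  fixes G :: "complex \<Rightarrow> complex \<Rightarrow> complex \<Rightarrow> complex" and q0 :: "int \<Rightarrow> complex"
  assumes lip: "\<And>a b c a' b' c'. cmod (G a b c - G a' b' c') \<le>
      \<Lambda> * (cmod (a - a') + cmod (b - b') + cmod (c - c'))"
    and G0: "G 0 0 0 = 0" and nn: "0 \<le> \<Lambda>" "0 \<le> D"
    and q0: "\<And>n. cmod (q0 n) \<le> b n"
    and b: "\<And>n. b (n + 1) \<le> D * b n" "\<And>n. b (n - 1) \<le> D * b n" "\<And>n. b n \<le> K"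
  shows "\<exists>(q :: real \<Rightarrow> int \<Rightarrow> complex) L. q 0 = q0 \<and>
    (\<forall>t n. ((\<lambda>s. q s n) has_vector_derivative G (q t (n + 1)) (q t n) (q t (n - 1))) (at t)) \<and>
    (\<forall>t n. cmod (q t n) \<le> 2 * exp (L * \<bar>t\<bar>) * b n)"
proof -
  \<comment> \<open>The first summand makes \<open>S\<close> invariant, the second gives contraction
    factor 1/2, and the 1 keeps \<open>L\<close> positive when \<open>\<Lambda> = 0\<close>.\<close>
  define L where "L = 2 * \<Lambda> * (1 + 2 * D) + 6 * \<Lambda> + 1"
  define e where "e t = exp (L * \<bar>t\<bar>)" for t :: real
  have L0: "L > 0" using nn by (simp add: L_def add_nonneg_pos)
  have e0: "e t > 0" for t by (simp add: e_def)
  have ce: "continuous_on UNIV e" unfolding e_def by (intro continuous_intros)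
  have b0: "b n \<ge> 0" for n using q0[of n] norm_ge_zero order_trans by blast
  \<comment> \<open>The vector field at site \<open>n\<close>, evaluated on the unscaled sequence
    \<open>e t * p\<close>.\<close>
  define N where "N p n t = G (e t * apply_bcontfun p (t, n + 1))
     (e t * apply_bcontfun p (t, n)) (e t * apply_bcontfun p (t, n - 1))"
    for p :: "(real \<times> int) \<Rightarrow>\<^sub>C complex" and n :: int and t :: real
  have cp: "continuous_on UNIV (\<lambda>t. e t * apply_bcontfun p (t, n))" for p :: "(real \<times> int) \<Rightarrow>\<^sub>C complex" and n
  proof -
    have "continuous_on UNIV (\<lambda>t. apply_bcontfun p (t, n))"
      by (rule continuous_on_compose2[OF continuous_on_apply_bcontfun[of UNIV p]])
        (auto intro!: continuous_intros)
    then show ?thesis using ce by (intro continuous_intros)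
  qed
  have cN: "continuous_on UNIV (N p n)" for p n
    unfolding continuous_on_def
  proof (intro ballI)
    fix t :: real
    let ?f = "\<lambda>n s. e s * apply_bcontfun p (s, n)"
    have lim: "((\<lambda>s. cmod (?f n s - ?f n t)) \<longlongrightarrow> 0) (at t)" for n
      using cp[of p n] unfolding continuous_on_def by (auto simp: tendsto_norm_zero_iff LIM_zero_iff)
    have "((\<lambda>s. N p n s - N p n t) \<longlongrightarrow> 0) (at t)"
    proof (rule Lim_null_comparison)
      show "\<forall>\<^sub>F s in at t. norm (N p n s - N p n t) \<le> \<Lambda> * (cmod (?f (n + 1) s - ?f (n + 1) t)
          + cmod (?f n s - ?f n t) + cmod (?f (n - 1) s - ?f (n - 1) t))"
        unfolding N_def by (intro always_eventually allI lip)
      show "((\<lambda>s. \<Lambda> * (cmod (?f (n + 1) s - ?f (n + 1) t)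
          + cmod (?f n s - ?f n t) + cmod (?f (n - 1) s - ?f (n - 1) t))) \<longlongrightarrow> 0) (at t)"
        by (intro tendsto_mult_right_zero tendsto_add_zero lim)
    qed
    then show "(N p n \<longlongrightarrow> N p n t) (at t within UNIV)" by (simp add: LIM_zero_iff)
  qed
  obtain A where A0: "\<And>p n. A p n 0 = 0"
    and A: "\<And>p n t. (A p n has_vector_derivative N p n t) (at t)"
    using continuous_antiderivative[OF cN] by metis
  define T where "T p = Bcontfun (\<lambda>(t, n). (q0 n + A p n t) / e t)" for p
  define S where "S = (PiC UNIV (\<lambda>(t, n). cball 0 (2 * b n)) :: ((real \<times> int) \<Rightarrow>\<^sub>C complex) set)"
  have S_iff: "p \<in> S \<longleftrightarrow> (\<forall>t n. cmod (apply_bcontfun p (t, n)) \<le> 2 * b n)" for p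
    by (auto simp: S_def mem_PiC_iff Pi_iff)
  \<comment> \<open>Of the allowance \<open>2 * b n\<close>, one \<open>b n\<close> pays for the
    initial value and the other for the integral. The neighbours enter through
    \<open>b (n + 1), b (n - 1) \<le> D * b n\<close>.\<close>
  have Tbound: "cmod ((q0 n + A p n t) / e t) \<le> 2 * b n" if "p \<in> S" for p t n
  proof -
    have "cmod (N p n s) \<le> 2 * \<Lambda> * (1 + 2 * D) * b n * exp (L * \<bar>s\<bar>)" for s
    proof -
      have pm: "cmod (e s * apply_bcontfun p (s, m)) \<le> e s * (2 * b m)" for m
        using that e0[of s] unfolding S_iff norm_mult by (intro mult_mono) auto
      have "cmod (N p n s) \<le> \<Lambda> * (e s * (2 * b (n + 1)) + e s * (2 * b n) + e s * (2 * b (n - 1)))"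
        using lip[of "e s * apply_bcontfun p (s, n + 1)" "e s * apply_bcontfun p (s, n)"
            "e s * apply_bcontfun p (s, n - 1)" 0 0 0]
        unfolding N_def G0 diff_zero
        by (rule order_trans) (intro mult_left_mono add_mono pm nn)
      also have "\<dots> = \<Lambda> * e s * 2 * (b (n + 1) + b n + b (n - 1))"
        by (simp add: algebra_simps)
      also have "\<dots> \<le> \<Lambda> * e s * 2 * (D * b n + b n + D * b n)"
        using e0[of s] nn by (intro mult_left_mono add_mono b) auto
      finally show ?thesis by (simp add: e_def algebra_simps)
    qed
    from antiderivative_exp_bound[OF A0 A this L0]
    have "cmod (A p n t) \<le> 2 * \<Lambda> * (1 + 2 * D) * b n / L * e t" by (simp add: e_def)
    also have "\<dots> \<le> b n * e t"
    proof (rule mult_right_mono)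
      have "2 * \<Lambda> * (1 + 2 * D) * b n \<le> L * b n"
        using nn b0 by (intro mult_right_mono) (auto simp: L_def)
      then show "2 * \<Lambda> * (1 + 2 * D) * b n / L \<le> b n" using L0 by (simp add: field_simps)
    qed (use e0 less_imp_le in blast)
    finally have "cmod (A p n t) \<le> b n * e t" .
    moreover have "cmod (q0 n) \<le> b n * e t"
    proof -
      have "1 \<le> e t" using L0 by (simp add: e_def)
      then show ?thesis using q0[of n] b0[of n] by (smt (verit) mult_le_cancel_left1)
    qed
    ultimately have "cmod (q0 n + A p n t) \<le> 2 * b n * e t"
      using norm_triangle_ineq[of "q0 n" "A p n t"] by linarith
    then show ?thesis using e0[of t] by (simp add: norm_divide field_simps)
  qed
  \<comment> \<open>Justifies the use of \<open>Bcontfun\<close> in \<open>T\<close>: for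
    \<open>p\<close> in \<open>S\<close> the Picard iterate is continuous and bounded by
    \<open>2 * K\<close>.\<close>
  have T: "apply_bcontfun (T p) (t, n) = (q0 n + A p n t) / e t" if "p \<in> S" for p t n
  proof -
    have "(\<lambda>(t, n). (q0 n + A p n t) / e t) \<in> bcontfun"
    proof (rule bcontfun_normI)
      show "continuous_on UNIV (\<lambda>(t, n). (q0 n + A p n t) / complex_of_real (e t))"
      proof (rule continuous_on_times_int, simp)
        fix n
        have "continuous_on UNIV (A p n)"
          by (intro continuous_at_imp_continuous_on ballI has_vector_derivative_continuous[OF A])
        then show "continuous_on UNIV (\<lambda>t. (q0 n + A p n t) / complex_of_real (e t))"
          using ce e0 by (intro continuous_intros) (auto simp: less_imp_neq[THEN not_sym])
      qed
      show "norm (case x of (t, n) \<Rightarrow> (q0 n + A p n t) / complex_of_real (e t)) \<le> 2 * K" for x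
      proof (cases x)
        case (Pair t n)
        then show ?thesis using Tbound[OF that, of n t] b(3)[of n] by simp
      qed
    qed
    then show ?thesis unfolding T_def by (simp add: Bcontfun_inverse)
  qed
  have "\<exists>!p. p \<in> S \<and> T p = p"
  proof (rule Banach_fix[of S "1/2"])
    show "complete S"
      unfolding S_def by (rule complete_PiC) auto
    have "const_bcontfun 0 \<in> S"
      unfolding S_iff using b0 by (simp add: const_bcontfun.rep_eq)
    then show "S \<noteq> {}" by auto
    show "T ` S \<subseteq> S"
    proof safe
      fix p assume "p \<in> S"
      then show "T p \<in> S" using Tbound by (subst S_iff) (simp add: T)
    qed
    fix p p' assume p: "p \<in> S" and p': "p' \<in> S"
    show "dist (T p) (T p') \<le> 1/2 * dist p p'"
    proof (rule dist_bound)
      fix x :: "real \<times> int"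
      obtain t n where x: "x = (t, n)" by force
      have "cmod (N p n s - N p' n s) \<le> 3 * \<Lambda> * dist p p' * exp (L * \<bar>s\<bar>)" for s
      proof -
        have pm: "cmod (e s * apply_bcontfun p (s, m) - e s * apply_bcontfun p' (s, m)) \<le> e s * dist p p'" for m
          using dist_bounded[of p "(s, m)" p'] e0[of s]
          by (simp flip: right_diff_distrib add: norm_mult dist_norm)
        have "cmod (N p n s - N p' n s) \<le> \<Lambda> * (e s * dist p p' + e s * dist p p' + e s * dist p p')"
          unfolding N_def by (rule order_trans[OF lip]) (intro mult_left_mono add_mono pm nn)
        then show ?thesis by (simp add: e_def algebra_simps)
      qed
      from antiderivative_exp_bound[OF _ has_vector_derivative_diff[OF A A] this L0, of t]
      have "cmod (A p n t - A p' n t) \<le> 3 * \<Lambda> * dist p p' / L * e t" by (simp add: A0 e_def)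
      also have "\<dots> \<le> 1/2 * dist p p' * e t"
      proof (rule mult_right_mono)
        have "6 * \<Lambda> * dist p p' \<le> L * dist p p'"
          using nn by (intro mult_right_mono) (auto simp: L_def)
        then show "3 * \<Lambda> * dist p p' / L \<le> 1/2 * dist p p'" using L0 by (simp add: field_simps)
      qed (use e0 less_imp_le in blast)
      finally have "cmod (A p n t - A p' n t) \<le> 1/2 * dist p p' * e t" .
      moreover have "apply_bcontfun (T p) x - apply_bcontfun (T p') x = (A p n t - A p' n t) / e t"
        unfolding x by (simp add: T p p' flip: diff_divide_distrib)
      ultimately show "dist (apply_bcontfun (T p) x) (apply_bcontfun (T p') x) \<le> 1/2 * dist p p'"
        using e0[of t] by (simp add: dist_norm[of "apply_bcontfun _ _"] norm_divide pos_divide_le_eq)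
    qed
  qed auto
  then obtain p where p: "p \<in> S" "T p = p" by blast
  define q where "q t n = e t * apply_bcontfun p (t, n)" for t n
  have q: "q t n = q0 n + A p n t" for t n
    using T[OF p(1), of t n] e0[of t] by (simp add: q_def p(2))
  have "((\<lambda>s. q s n) has_vector_derivative G (q t (n + 1)) (q t n) (q t (n - 1))) (at t)" for t n
  proof -
    have "((\<lambda>s. q0 n + A p n s) has_vector_derivative N p n t) (at t)"
      using has_vector_derivative_add[OF has_vector_derivative_const A] by simp
    then show ?thesis by (simp only: N_def q q_def[symmetric])
  qed
  moreover have "q 0 = q0" by (rule ext) (simp add: q A0)
  moreover have "cmod (q t n) \<le> 2 * exp (L * \<bar>t\<bar>) * b n" for t n
    using p(1) e0[of t] by (simp add: S_iff q_def norm_mult e_def)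
  ultimately show ?thesis by blast
qed

section \<open>Invariance of the closed unit disc\<close>

text \<open>Squaring removes the corner of the positive part: at 0 the difference quotient is at
  most \<open>|h|\<close>. Hence the chain rule applies also at times when a trajectory crosses the
  unit circle.\<close>

lemma has_real_derivative_max_square:
  "((\<lambda>x::real. (max 0 x)\<^sup>2) has_real_derivative 2 * max 0 x) (at x)"
proof -
  consider "x > 0" | "x < 0" | "x = 0" by linarith
  then show ?thesis
  proof cases
    case 1
    have "((\<lambda>x::real. x\<^sup>2) has_real_derivative 2 * max 0 x) (at x)"
      using 1 by (auto intro!: derivative_eq_intros)
    then show ?thesis
      by (rule has_field_derivative_transform_within_open[of _ _ _ "{0<..}"]) (use 1 in auto)
  next
    case 2
    have "((\<lambda>x::real. 0) has_real_derivative 2 * max 0 x) (at x)"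
      using 2 by simp
    then show ?thesis
      by (rule has_field_derivative_transform_within_open[of _ _ _ "{..<0}"]) (use 2 in auto)
  next
    case 3
    have "((\<lambda>h::real. (max 0 h)\<^sup>2 / h) \<longlongrightarrow> 0) (at 0)"
      by (rule Lim_null_comparison[of _ "\<lambda>h. \<bar>h\<bar>"])
        (auto intro!: always_eventually tendsto_eq_intros simp: max_def power2_eq_square)
    then show ?thesis by (simp add: 3 DERIV_def)
  qed
qed

lemma unit_ball_invariant:
  fixes z :: "real \<Rightarrow> complex"
  assumes z: "\<And>t. (z has_vector_derivative d t) (at t)"
    and d: "\<And>t. cmod (z t) > 1 \<Longrightarrow> z t \<bullet> d t = 0" and "cmod (z 0) \<le> 1"
  shows "cmod (z t) \<le> 1"
proof -
  \<comment> \<open>The derivative of \<open>(max 0 u)\<^sup>2\<close> is \<open>2 * max 0 u * u'\<close>, which vanishes identically.\<close>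
  define u where "u t = z t \<bullet> z t - 1" for t
  have u_norm: "u t = (cmod (z t))\<^sup>2 - 1" for t by (simp add: u_def dot_square_norm)
  have du: "(u has_real_derivative 2 * (z t \<bullet> d t)) (at t)" for t
  proof -
    have "(u has_derivative (\<lambda>h. z t \<bullet> (h *\<^sub>R d t) + (h *\<^sub>R d t) \<bullet> z t - 0)) (at t)"
      unfolding u_def using z[of t]
      by (intro has_derivative_diff has_derivative_inner has_derivative_const)
        (auto simp: has_vector_derivative_def)
    then show ?thesis
      unfolding has_field_derivative_def
      by (rule has_derivative_eq_rhs) (auto simp: inner_commute fun_eq_iff)
  qed
  have "((\<lambda>t. (max 0 (u t))\<^sup>2) has_real_derivative 0) (at t)" for t
  proof -
    have "2 * max 0 (u t) * (2 * (z t \<bullet> d t)) = 0"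
    proof (cases "cmod (z t) > 1")
      case False
      then have "u t \<le> 0" by (simp add: u_norm power_le_one)
      then show ?thesis by simp
    qed (simp add: d)
    then show ?thesis
      using DERIV_chain2[OF has_real_derivative_max_square du, of t] by (simp only:)
  qed
  then have "(max 0 (u t))\<^sup>2 = (max 0 (u 0))\<^sup>2"
    by (intro DERIV_isconst_all) auto
  also have "u 0 \<le> 0" using assms(3) by (simp add: u_norm power_le_one)
  then have "(max 0 (u 0))\<^sup>2 = 0" by simp
  finally have "(cmod (z t))\<^sup>2 \<le> 1\<^sup>2" by (simp add: u_norm)
  then show ?thesis by (rule power2_le_imp_le) simp
qed

section \<open>The truncated Ablowitz-Ladik system\<close>

theorem mainTheorem3:
  fixes k :: nat and q0 :: "int \<Rightarrow> complex"
  assumes "k \<ge> 1"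
    and "q0 \<in> l2_weighted k"
    and "sup_norm q0 < 1"
  shows "\<exists>q :: real \<Rightarrow> int \<Rightarrow> complex.
           q 0 = q0 \<and> defocusing_AL_solution q \<and> (\<forall>t. t \<noteq> 0 \<longrightarrow> q t \<in> l2_weighted k)"
proof -
  obtain b K where b: "\<And>n. cmod (q0 n) \<le> b n" "\<And>n. b (n + 1) \<le> 2 ^ (k + 1) * b n"
    "\<And>n. b (n - 1) \<le> 2 ^ (k + 1) * b n" "\<And>n. b n \<le> K"
    "(\<lambda>n. (1 + (real_of_int n)\<^sup>2) ^ k * (b n)\<^sup>2) summable_on UNIV"
    by (rule l2_weighted_slowly_varying_majorant[OF assms(2)], rule that)
  have q0_le: "cmod (q0 n) \<le> 1" for n
  proof -
    have "bdd_above (range (\<lambda>n. cmod (q0 n)))"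
      using b(1,4) by (intro bdd_aboveI2) (rule order_trans)
    then have "cmod (q0 n) \<le> sup_norm q0"
      unfolding sup_norm_def by (intro cSUP_upper) auto
    then show ?thesis using assms(3) by simp
  qed
  define P :: "complex \<Rightarrow> complex" where "P = closest_point (cball 0 1)"
  \<comment> \<open>The equation multiplied by \<open>-\<i>\<close>, truncated. The term
    \<open>2 * \<i> * b\<close> keeps its argument: it is already Lipschitz and is orthogonal to
    \<open>b\<close>, so it does not change the modulus.\<close>
  define G where "G a b c = 2 * \<i> * b - \<i> * (P a + P c) * (1 - (cmod (P b))\<^sup>2)" for a b c
  have P_le: "cmod (P z) \<le> 1" for z
    using closest_point_in_set[of "cball 0 1" z] by (simp add: P_def)
  have P_lip: "cmod (P z - P w) \<le> cmod (z - w)" for z w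
    using closest_point_lipschitz[of "cball 0 1" z w] by (simp add: P_def dist_norm)
  have P_id: "P z = z" if "cmod z \<le> 1" for z
    using that by (simp add: P_def closest_point_self)
  have P_out: "cmod (P z) = 1" if "cmod z > 1" for z
  proof -
    \<comment> \<open>The radial point \<open>z / |z|\<close> is a competitor at distance
      \<open>|z| - 1\<close>, which forces \<open>|P z| \<ge> 1\<close>.\<close>
    have "dist z (P z) \<le> dist z (z /\<^sub>R cmod z)"
      unfolding P_def by (rule closest_point_le) (use that in \<open>auto simp: field_simps\<close>)
    also have "\<dots> = cmod ((1 - 1 / cmod z) *\<^sub>R z)"
      by (simp add: dist_norm algebra_simps divide_inverse)
    also have "\<dots> = cmod z - 1"
    proof -
      have "z \<noteq> 0" using that by auto
      moreover from this have "0 \<le> 1 - 1 / cmod z" using that by (simp add: field_simps)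
      ultimately show ?thesis by (simp add: field_simps)
    qed
    finally show ?thesis
      using P_le[of z] norm_triangle_ineq2[of z "P z"] by (simp add: dist_norm)
  qed
  have G_lip: "cmod (G a b c - G a' b' c') \<le> 6 * (cmod (a - a') + cmod (b - b') + cmod (c - c'))"
    for a b c a' b' c'
  proof -
    let ?r = "1 - (cmod (P b))\<^sup>2" and ?r' = "1 - (cmod (P b'))\<^sup>2"
    have r: "\<bar>?r\<bar> \<le> 1" using P_le[of b] by (simp add: abs_le_iff power_le_one)
    have "?r - ?r' = (cmod (P b') - cmod (P b)) * (cmod (P b') + cmod (P b))"
      by (simp add: power2_eq_square algebra_simps)
    then have "\<bar>?r - ?r'\<bar> = \<bar>cmod (P b') - cmod (P b)\<bar> * (cmod (P b') + cmod (P b))"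
      by (simp only: abs_mult) simp
    also have "\<dots> \<le> cmod (b - b') * 2"
    proof (rule mult_mono)
      show "\<bar>cmod (P b') - cmod (P b)\<bar> \<le> cmod (b - b')"
        using norm_triangle_ineq3[of "P b'" "P b"] P_lip[of b' b] by (simp add: norm_minus_commute)
      show "cmod (P b') + cmod (P b) \<le> 2" using P_le[of b] P_le[of b'] by simp
    qed auto
    finally have rr: "\<bar>?r - ?r'\<bar> \<le> 2 * cmod (b - b')" by simp
    have PP: "cmod (P a' + P c') \<le> 2"
      using norm_triangle_ineq[of "P a'" "P c'"] P_le[of a'] P_le[of c'] by simp
    have dP: "cmod ((P a - P a') + (P c - P c')) \<le> cmod (a - a') + cmod (c - c')"
      using norm_triangle_ineq[of "P a - P a'" "P c - P c'"] P_lip[of a a'] P_lip[of c c'] by simp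
    \<comment> \<open>Increments of the linear term, of the neighbours, and of the factor
      \<open>1 - |P b|^2\<close>. The first and third contribute \<open>2 + 2 * 2 = 6\<close> to the
      coefficient of \<open>|b - b'|\<close>, hence the constant.\<close>
    define x y z where "x = 2 * \<i> * (b - b')"
      and "y = \<i> * (((P a - P a') + (P c - P c')) * of_real ?r)"
      and "z = \<i> * ((P a' + P c') * of_real (?r - ?r'))"
    have "G a b c - G a' b' c' = x - y - z"
      by (simp add: G_def x_def y_def z_def algebra_simps)
    also have "cmod \<dots> \<le> cmod x + cmod y + cmod z"
      using norm_triangle_ineq4[of "x - y" z] norm_triangle_ineq4[of x y] by linarith
    also have "\<dots> = 2 * cmod (b - b') + cmod ((P a - P a') + (P c - P c')) * \<bar>?r\<bar>
        + cmod (P a' + P c') * \<bar>?r - ?r'\<bar>"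
      unfolding x_def y_def z_def norm_mult norm_of_real by simp
    also have "\<dots> \<le> 2 * cmod (b - b') + (cmod (a - a') + cmod (c - c')) * 1
        + 2 * (2 * cmod (b - b'))"
      by (intro add_mono mult_mono dP r rr PP order_refl) auto
    also have "\<dots> \<le> 6 * (cmod (a - a') + cmod (b - b') + cmod (c - c'))"
      by simp
    finally show ?thesis .
  qed
  have "G 0 0 0 = 0" by (simp add: G_def P_id)
  then obtain q :: "real \<Rightarrow> int \<Rightarrow> complex" and L where q: "q 0 = q0"
    "\<And>t n. ((\<lambda>s. q s n) has_vector_derivative G (q t (n + 1)) (q t n) (q t (n - 1))) (at t)"
    "\<And>t n. cmod (q t n) \<le> 2 * exp (L * \<bar>t\<bar>) * b n"
    using lattice_ode_solution[of G 6 "2 ^ (k + 1)" q0 b K] G_lip b(1-4) by auto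
  have q_le: "cmod (q t n) \<le> 1" for t n
  proof (rule unit_ball_invariant[OF q(2)])
    \<comment> \<open>Outside the disc \<open>|P (q t n)| = 1\<close> cancels the coupling and
      leaves the rotation \<open>2 * \<i> * q t n\<close>.\<close>
    show "q t n \<bullet> G (q t (n + 1)) (q t n) (q t (n - 1)) = 0" if "cmod (q t n) > 1" for t
      using that by (simp add: G_def P_out inner_complex_def)
    show "cmod (q 0 n) \<le> 1" by (simp add: q(1) q0_le)
  qed
  have "defocusing_AL_solution q"
    unfolding defocusing_AL_solution_def
  proof (intro allI exI conjI)
    show "((\<lambda>s. q s n) has_vector_derivative G (q t (n + 1)) (q t n) (q t (n - 1))) (at t)" for t n
      by (rule q(2))
    show "\<i> * G (q t (n + 1)) (q t n) (q t (n - 1)) = q t (n + 1) - 2 * q t n + q t (n - 1)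
        - complex_of_real ((cmod (q t n))\<^sup>2) * (q t (n + 1) + q t (n - 1))" for t n
      \<comment> \<open>By \<open>q_le\<close> every projection acts as the identity along the
        solution.\<close>
      by (simp add: G_def P_id q_le algebra_simps)
  qed
  moreover have "q t \<in> l2_weighted k" for t
  proof -
    \<comment> \<open>At fixed \<open>t\<close> the growth factor does not depend on
      \<open>n\<close>, so the summability of \<open>b\<close> carries over.\<close>
    let ?c = "(2 * exp (L * \<bar>t\<bar>))\<^sup>2"
    have "(\<lambda>n. ?c * ((1 + (real_of_int n)\<^sup>2) ^ k * (b n)\<^sup>2)) summable_on UNIV"
      by (rule summable_on_cmult_right[OF b(5)])
    then have "(\<lambda>n. (1 + (real_of_int n)\<^sup>2) ^ k * (cmod (q t n))\<^sup>2) summable_on UNIV"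
    proof (rule summable_on_comparison_test)
      fix n :: int
      have "(cmod (q t n))\<^sup>2 \<le> (2 * exp (L * \<bar>t\<bar>) * b n)\<^sup>2"
        by (rule power_mono[OF q(3)]) simp
      then have "(1 + (real_of_int n)\<^sup>2) ^ k * (cmod (q t n))\<^sup>2
          \<le> (1 + (real_of_int n)\<^sup>2) ^ k * (2 * exp (L * \<bar>t\<bar>) * b n)\<^sup>2"
        by (rule mult_left_mono) simp
      then show "(1 + (real_of_int n)\<^sup>2) ^ k * (cmod (q t n))\<^sup>2
          \<le> ?c * ((1 + (real_of_int n)\<^sup>2) ^ k * (b n)\<^sup>2)"
        by (simp add: power_mult_distrib mult_ac)
    qed simp
    then show ?thesis by (simp add: l2_weighted_def)
  qed
  ultimately show ?thesis using q(1) by blast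
qed

end
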